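(* There exist $\eta>0$, $\theta\in[0,1)$ and holomorphic functions $U,V$ on the disc $\{\tau\in\mathbb C:|\tau|\le\eta\}$ such that $$\mathbb E_N\bigl[(\mathbf S_N)^\tau\bigr]=\exp\{NU(\tau)+V(\tau)\}\,\bigl(1+O(\theta^N)\bigr)$$ uniformly in $N\ge1$ and $|\tau|\le\eta$. Moreover, $U''(0)\ne0$.
   Context: The Stern sequence $(s(n))_{n\ge0}$ is defined by $s(0)=0$, $s(1)=1$, and $s(2n)=s(n)$, $s(2n+1)=s(n)+s(n+1)$ for all $n\ge1$. For $N\ge0$ let $\mathcal I_N=\mathbb Z\cap[2^N,2^{N+1})$, endowed with the uniform probability measure; $\mathbf S_N$ is the random variable $\mathbf S_N=s(n)$ with $n$ uniformly random in $\mathcal I_N$, and $\mathbb E_N$ is the corresponding expectation. For $\tau\in\mathbb C$, $(\mathbf S_N)^\tau=\exp(\tau\log\mathbf S_N)$. A function is holomorphic on a closed disc if it is holomorphic in a neighborhood of it. *)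

theory Defs
  imports "HOL-Probability.Probability" "HOL-Complex_Analysis.Complex_Analysis"
begin

function stern :: "nat \<Rightarrow> nat" where
  "stern n = (if n < 2 then n
              else if even n then stern (n div 2)
              else stern (n div 2) + stern (n div 2 + 1))"
  by pat_completeness auto
termination
proof (relation "Wellfounded.measure id", goal_cases)
  case (4 n)
  then have "3 \<le> n" by presburger
  then show ?case by simp
qed auto

declare stern.simps [simp del]

lemma stern_0: "stern 0 = 0"
  and stern_1: "stern 1 = 1"
  by (simp_all add: stern.simps)

lemma stern_even: "n \<ge> 1 \<Longrightarrow> stern (2 * n) = stern n"
  by (subst stern.simps) simp

lemma stern_odd: "n \<ge> 1 \<Longrightarrow> stern (2 * n + 1) = stern n + stern (n + 1)"
  by (subst stern.simps) simp

definition stern_interval :: "nat \<Rightarrow> nat set" where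
  "stern_interval N = {2 ^ N..<2 ^ (N + 1)}"

lemma stern_interval_finite: "finite (stern_interval N)"
  and stern_interval_nonempty: "stern_interval N \<noteq> {}"
  by (simp_all add: stern_interval_def)

lemma stern_pos: "n \<ge> 1 \<Longrightarrow> stern n > 0"
proof (induction n rule: less_induct)
  case (less n)
  consider "n = 1" | m where "n = 2 * m" "m \<ge> 1" | m where "n = 2 * m + 1" "m \<ge> 1"
    using less.prems by (cases "even n"; cases "n = 1") (auto elim!: evenE oddE)
  then show ?case
    by cases (use less.IH in \<open>auto simp: stern_1[simplified] stern_even stern_odd[simplified]\<close>)
qed

text \<open>The uniform distribution on \<open>stern_interval N\<close> is \<^term>\<open>pmf_of_set (stern_interval N)\<close>, which is
  meaningful because the interval is finite and nonempty; the random variable \<open>S\<^sub>N\<close> is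
  \<^term>\<open>stern\<close> on this space. The real logarithm is applied to a positive number by
  \<open>stern_pos\<close>.\<close>

definition stern_moment :: "nat \<Rightarrow> complex \<Rightarrow> complex" where
  "stern_moment N \<tau> =
     measure_pmf.expectation (pmf_of_set (stern_interval N))
       (\<lambda>n. exp (\<tau> * of_real (ln (real (stern n)))))"

end

theory Submission
  imports Defs
begin

text \<open>Passing from \<open>n\<close> to \<open>2n\<close> or \<open>2n + 1\<close> sends the pair \<open>(a, b) = (s(n), s(n + 1))\<close> to \<open>(a, a + b)\<close> or
  \<open>(a + b, b)\<close>. In terms of the ratio \<open>x = a / (a + b)\<close>, moments of \<open>a + b\<close> are iterates of the transfer
  operator of the two Farey branches \<open>x / (1 + x)\<close> and \<open>1 / (2 - x)\<close>, weighted by \<open>(1 + x) powr \<tau>\<close> and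
  \<open>(2 - x) powr \<tau>\<close>. The branches contract on average by the factor \<open>5 / 8\<close>, so for small \<open>\<tau>\<close> the
  iterates of 1, normalised to have value 1 at \<open>1 / 2\<close>, converge geometrically in the Lipschitz
  seminorm. The successive normalising factors then converge uniformly and geometrically to a
  holomorphic eigenvalue \<open>\<lambda>(\<tau>)\<close>; no spectral perturbation theory is needed, and \<open>U = Ln \<lambda>\<close>.

  If \<open>U''(0) = 0\<close>, Cauchy's inequality would bound the variance of \<open>ln (a + b)\<close> uniformly in the number
  of steps. But that variance is one quarter of a sum of expected squared gaps between the conditional means
  after a left and a right step. At the parabolic fixed point \<open>x = 0\<close> the left step contributes no growth
  while the mean growth per step is at least \<open>ln 2 / 2\<close>, so the gap is at least \<open>ln 2\<close> there; as every
  starting point comes close to 0 with positive probability in 64 steps, the variance is unbounded.\<close>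

section \<open>Geometric limits and Lipschitz bounds\<close>

text \<open>The increments are absolutely summable, so completeness gives the limit, and the error
  at \<open>n\<close> is a telescoping tail. The bound depends only on \<open>A\<close> and
  \<open>r\<close>, hence is uniform in any parameter of \<open>a\<close>.\<close>

lemma norm_diff_le_geometric_limit:
  fixes a :: "nat \<Rightarrow> 'a::banach"
  assumes step: "\<And>k. norm (a (Suc k) - a k) \<le> A * r ^ k" and "0 \<le> r" "r < 1"
  shows "norm (a n - lim a) \<le> A / (1 - r) * r ^ n"
proof -
  define d where "d k = a (Suc k) - a k" for k
  have bnd: "summable (\<lambda>k. A * r ^ n * r ^ k)"
    using assms by (intro summable_mult summable_geometric) auto
  have le: "norm (d (k + n)) \<le> A * r ^ n * r ^ k" for k
    using step[of "k + n"] by (simp add: d_def power_add mult_ac)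
  have "summable (\<lambda>k. d (k + n))"
    by (rule summable_comparison_test'[OF bnd, of 0]) (use le in auto)
  then have "(\<lambda>m. \<Sum>k<m. d (k + n)) \<longlonglongrightarrow> (\<Sum>k. d (k + n))"
    by (rule summable_LIMSEQ)
  moreover have "(\<Sum>k<m. d (k + n)) = a (m + n) - a n" for m
    by (induction m) (auto simp: d_def)
  ultimately have "(\<lambda>m. a (m + n) - a n) \<longlonglongrightarrow> (\<Sum>k. d (k + n))"
    by simp
  then have "(\<lambda>m. a (m + n) - a n + a n) \<longlonglongrightarrow> (\<Sum>k. d (k + n)) + a n"
    by (intro tendsto_intros)
  then have "a \<longlonglongrightarrow> (\<Sum>k. d (k + n)) + a n"
    by (simp add: LIMSEQ_offset)
  then have "lim a = (\<Sum>k. d (k + n)) + a n"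
    by (rule limI)
  then have "norm (a n - lim a) = norm (\<Sum>k. d (k + n))"
    by simp
  also have "\<dots> \<le> (\<Sum>k. A * r ^ n * r ^ k)"
    by (rule norm_suminf_le[OF le bnd])
  also have "\<dots> = A / (1 - r) * r ^ n"
    using assms by (subst suminf_mult) (auto simp: suminf_geometric summable_geometric)
  finally show ?thesis .
qed

text \<open>The tail bound does not involve \<open>z\<close>, so convergence is uniform on
  \<open>S\<close> and holomorphy passes to the limit.\<close>

lemma holomorphic_on_geometric_limit:
  fixes f :: "nat \<Rightarrow> complex \<Rightarrow> complex"
  assumes "open S" and hol: "\<And>k. f k holomorphic_on S"
    and step: "\<And>k z. z \<in> S \<Longrightarrow> norm (f (Suc k) z - f k z) \<le> A * r ^ k"
    and "0 \<le> r" "r < 1"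
  shows "(\<lambda>z. lim (\<lambda>k. f k z)) holomorphic_on S"
proof (rule holomorphic_uniform_sequence[OF \<open>open S\<close> hol])
  fix x assume "x \<in> S"
  with \<open>open S\<close> obtain d where d: "d > 0" "cball x d \<subseteq> S"
    by (auto simp: open_contains_cball)
  have lim0: "(\<lambda>n. A / (1 - r) * r ^ n) \<longlonglongrightarrow> A / (1 - r) * 0"
    using assms by (intro tendsto_intros LIMSEQ_power_zero) auto
  have "uniform_limit S f (\<lambda>z. lim (\<lambda>k. f k z)) sequentially"
  proof (rule uniform_limitI)
    fix e :: real assume "e > 0"
    with lim0 have "\<forall>\<^sub>F n in sequentially. A / (1 - r) * r ^ n < e"
      by (intro order_tendstoD(2)[of _ 0]) auto
    then show "\<forall>\<^sub>F n in sequentially. \<forall>z\<in>S. dist (f n z) (lim (\<lambda>k. f k z)) < e"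
    proof eventually_elim
      case (elim n)
      then show ?case
        unfolding dist_norm
        by (intro ballI le_less_trans[OF norm_diff_le_geometric_limit[OF step assms(4,5)]])
    qed
  qed
  then show "\<exists>d>0. cball x d \<subseteq> S \<and> uniform_limit (cball x d) f (\<lambda>z. lim (\<lambda>k. f k z)) sequentially"
    using d uniform_limit_on_subset by blast
qed

lemma norm_exp_mult_diff_le:
  fixes z :: complex
  assumes "s \<in> {0..1}" "t \<in> {0..1}"
  shows "norm (exp (z * of_real s) - exp (z * of_real t)) \<le> norm z * exp (norm z) * \<bar>s - t\<bar>"
proof -
  have "norm (exp (z * of_real s) - exp (z * of_real t))
      \<le> norm z * exp (norm z) * norm (of_real s - of_real t :: complex)"
  proof (rule field_differentiable_bound[of "cball 0 1" _ "\<lambda>u. z * exp (z * u)"])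
    show "((\<lambda>u. exp (z * u)) has_field_derivative z * exp (z * u)) (at u within cball 0 1)" for u
      by (auto intro!: derivative_eq_intros)
    fix u :: complex assume u: "u \<in> cball 0 1"
    have "norm (exp (z * u)) \<le> exp (norm (z * u))"
      by (rule norm_exp)
    also have "\<dots> \<le> exp (norm z)"
      using u by (auto simp: norm_mult intro: mult_left_le)
    finally show "norm (z * exp (z * u)) \<le> norm z * exp (norm z)"
      by (simp add: norm_mult mult_left_mono)
  qed (use assms in auto)
  also have "norm (of_real s - of_real t :: complex) = \<bar>s - t\<bar>"
    by (metis norm_of_real of_real_diff)
  finally show ?thesis .
qed

lemma lipschitz_on_mult_const:
  fixes f :: "'a::metric_space \<Rightarrow> 'b::real_normed_field"
  assumes "C-lipschitz_on U f"
  shows "(norm c * C)-lipschitz_on U (\<lambda>x. c * f x)"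
proof (rule lipschitz_onI)
  show "0 \<le> norm c * C" using lipschitz_on_nonneg[OF assms] by simp
  fix x y assume "x \<in> U" "y \<in> U"
  then have "norm (f x - f y) \<le> C * dist x y"
    using lipschitz_onD[OF assms] by (simp add: dist_norm)
  then have "norm c * norm (f x - f y) \<le> norm c * (C * dist x y)"
    by (intro mult_left_mono) auto
  then show "dist (c * f x) (c * f y) \<le> norm c * C * dist x y"
    by (simp add: dist_norm flip: norm_mult right_diff_distrib)
qed

lemma lipschitz_on_divide_const:
  fixes f :: "'a::metric_space \<Rightarrow> 'b::real_normed_field"
  assumes "L-lipschitz_on U f" "c > 0" "norm p \<ge> c" "L / c \<le> L'"
  shows "L'-lipschitz_on U (\<lambda>x. f x / p)"
proof -
  have "norm (1 / p) * L \<le> 1 / c * L"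
    using assms(2,3) lipschitz_on_nonneg[OF assms(1)]
    by (intro mult_right_mono) (auto simp: norm_divide intro: frac_le)
  then have "norm (1 / p) * L \<le> L'"
    using assms(4) by simp
  from lipschitz_on_le[OF lipschitz_on_mult_const[OF assms(1), of "1 / p"] this]
  show ?thesis by simp
qed

lemma abs_ln_diff_le:
  fixes x y :: real
  assumes "x \<ge> 1" "y \<ge> 1"
  shows "\<bar>ln x - ln y\<bar> \<le> \<bar>x - y\<bar>"
  using assms
proof (induction x y rule: linorder_wlog)
  case (le x y)
  have "ln y - ln x = ln (y / x)"
    using le by (simp add: ln_div)
  also have "\<dots> \<le> y / x - 1"
    using le by (intro ln_le_minus_one) auto
  also have "\<dots> = (y - x) / x"
    using le by (simp add: field_simps)
  also have "\<dots> \<le> y - x"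
    using le mult_left_mono[of 1 x "y - x"] by (simp add: divide_le_eq)
  finally show ?case using le by simp
qed (simp add: abs_minus_commute)

section \<open>Perturbed transfer operators of the Farey maps\<close>

definition farey_left :: "real \<Rightarrow> real" where
  "farey_left x = x / (1 + x)"

definition farey_right :: "real \<Rightarrow> real" where
  "farey_right x = 1 / (2 - x)"

lemma farey_left_mem: "x \<in> {0..1} \<Longrightarrow> farey_left x \<in> {0..1}"
  by (auto simp: farey_left_def field_simps)

lemma farey_right_mem: "x \<in> {0..1} \<Longrightarrow> farey_right x \<in> {0..1}"
  by (auto simp: farey_right_def field_simps)

text \<open>Both maps have derivative 1 at an end point of the unit interval, so neither of them is a
  contraction, but their average is.\<close>

lemma farey_average_contraction:
  assumes "x \<in> {0..1}" "y \<in> {0..1}"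
  shows "\<bar>farey_left x - farey_left y\<bar> + \<bar>farey_right x - farey_right y\<bar> \<le> 5 / 4 * \<bar>x - y\<bar>"
proof -
  \<comment> \<open>The summands are the derivatives of the two branches. As (1 + t)(2 - t) = 2 + q,
    the claim becomes 5 - 2q <= 5/4 (2 + q)^2, with equality at the end points q = 0.\<close>
  have sq: "1 / (1 + t)\<^sup>2 + 1 / (2 - t)\<^sup>2 \<le> 5 / 4" if "t \<in> {0..1}" for t :: real
  proof -
    define q where "q = t * (1 - t)"
    have q: "0 \<le> q" using that by (auto simp: q_def)
    have pos: "(1 + t)\<^sup>2 > 0" "(2 - t)\<^sup>2 > 0" using that by auto
    have prod: "(1 + t)\<^sup>2 * (2 - t)\<^sup>2 = (2 + q)\<^sup>2"
      unfolding q_def by algebra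
    have "(1 + t)\<^sup>2 + (2 - t)\<^sup>2 = 5 - 2 * q"
      unfolding q_def by algebra
    moreover have "5 - 2 * q \<le> 5 / 4 * (2 + q)\<^sup>2"
      using q by (simp add: power2_eq_square algebra_simps)
    ultimately show ?thesis
      using pos prod by (simp add: add_frac_eq divide_le_eq mult_ac add_ac)
  qed
  \<comment> \<open>The difference quotient of a branch is the geometric mean of its derivatives at
    \<open>x\<close> and \<open>y\<close>. The arithmetic mean separates the two points, so
    \<open>sq\<close> applies at each.\<close>
  have amgm: "1 / (a * b) \<le> (1 / a\<^sup>2 + 1 / b\<^sup>2) / 2" for a b :: real
    using sum_squares_ge_zero[of "1/a - 1/b" 0]
    by (simp add: power2_eq_square algebra_simps)
  have l: "\<bar>farey_left x - farey_left y\<bar> = \<bar>x - y\<bar> * (1 / ((1 + x) * (1 + y)))"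
  proof -
    have "farey_left x - farey_left y = (x - y) * (1 / ((1 + x) * (1 + y)))"
      using assms by (simp add: farey_left_def divide_simps) (simp add: algebra_simps)
    then show ?thesis using assms by (simp add: abs_mult)
  qed
  have r: "\<bar>farey_right x - farey_right y\<bar> = \<bar>x - y\<bar> * (1 / ((2 - x) * (2 - y)))"
  proof -
    have "farey_right x - farey_right y = (x - y) * (1 / ((2 - x) * (2 - y)))"
      using assms by (simp add: farey_right_def divide_simps)
    then show ?thesis using assms by (simp add: abs_mult)
  qed
  have "1 / ((1 + x) * (1 + y)) + 1 / ((2 - x) * (2 - y)) \<le> 5 / 4"
  proof -
    have combine: "a + b \<le> 5 / 4" if "a \<le> (c + d) / 2" "b \<le> (c' + d') / 2" "c + c' \<le> 5 / 4" "d + d' \<le> 5 / 4"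
      for a b c d c' d' :: real
      using that by simp
    show ?thesis by (rule combine[OF amgm amgm sq[OF assms(1)] sq[OF assms(2)]])
  qed
  from mult_left_mono[OF this, of "\<bar>x - y\<bar>"] show ?thesis
    unfolding l r by (simp add: algebra_simps)
qed

definition transfer :: "complex \<Rightarrow> (real \<Rightarrow> complex) \<Rightarrow> real \<Rightarrow> complex" where
  "transfer \<tau> f x =
     (exp (\<tau> * of_real (ln (1 + x))) * f (farey_left x) +
      exp (\<tau> * of_real (ln (2 - x))) * f (farey_right x)) / 2"

lemma transfer_diff: "transfer \<tau> (\<lambda>x. f x - g x) x = transfer \<tau> f x - transfer \<tau> g x"
  by (simp add: transfer_def algebra_simps add_divide_distrib diff_divide_distrib)

lemma transfer_divide: "transfer \<tau> (\<lambda>x. f x / c) x = transfer \<tau> f x / c"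
  by (simp add: transfer_def add_divide_distrib mult.commute)

lemma ln_mem_unit:
  assumes "x \<in> {1..2}" shows "ln x \<in> {0..1::real}"
  using assms ln_le_minus_one[of x] by auto

text \<open>For small \<open>\<tau>\<close> this class is invariant under \<open>h \<mapsto> transfer \<tau> h / transfer \<tau> h (1 / 2)\<close>, which
  contracts Lipschitz distances on it; the radius \<open>1 / 10\<close> leaves room for \<open>norm \<tau> \<le> 1 / 200\<close>.\<close>

definition normalized :: "(real \<Rightarrow> complex) \<Rightarrow> bool" where
  "normalized h \<longleftrightarrow> h (1 / 2) = 1 \<and> (1 / 10)-lipschitz_on {0..1} h"

section \<open>Contraction of the normalised transfer operator for small parameters\<close>

context
  fixes \<tau> :: complex
  assumes small: "norm \<tau> \<le> 1 / 200"
begin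

lemma norm_mult_exp_small: "norm \<tau> * exp (norm \<tau>) \<le> 1 / 100"
proof -
  have "exp (norm \<tau>) \<le> 2"
    using small exp_bound_half[of "norm \<tau>"] by simp
  then have "norm \<tau> * exp (norm \<tau>) \<le> 1 / 200 * 2"
    using small by (intro mult_mono) auto
  then show ?thesis by simp
qed

lemma weight_lipschitz:
  assumes "x \<in> {1..2}" "y \<in> {1..2}"
  shows "norm (exp (\<tau> * of_real (ln x)) - exp (\<tau> * of_real (ln y))) \<le> \<bar>x - y\<bar> / 100"
proof -
  have "norm (exp (\<tau> * of_real (ln x)) - exp (\<tau> * of_real (ln y)))
      \<le> norm \<tau> * exp (norm \<tau>) * \<bar>ln x - ln y\<bar>"
    using assms by (intro norm_exp_mult_diff_le ln_mem_unit)
  also have "\<dots> \<le> 1 / 100 * \<bar>x - y\<bar>"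
    using assms norm_mult_exp_small by (intro mult_mono abs_ln_diff_le) auto
  finally show ?thesis by simp
qed

lemma norm_weight_diff_1_le:
  assumes "x \<in> {1..2}"
  shows "norm (exp (\<tau> * of_real (ln x)) - 1) \<le> 1 / 100"
  using weight_lipschitz[OF assms, of 1] assms by auto

lemma norm_weight_le:
  assumes "x \<in> {1..2}"
  shows "norm (exp (\<tau> * of_real (ln x))) \<le> 101 / 100"
  using norm_weight_diff_1_le[OF assms] norm_triangle_ineq2[of "exp (\<tau> * of_real (ln x))" 1] by simp

lemma norm_transfer_le:
  assumes "norm (f (farey_left x)) \<le> M" "norm (f (farey_right x)) \<le> M" "x \<in> {0..1}"
  shows "norm (transfer \<tau> f x) \<le> 101 / 100 * M"
proof -
  have "norm (exp (\<tau> * of_real (ln (1 + x))) * f (farey_left x)) \<le> 101 / 100 * M"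
    unfolding norm_mult using assms by (intro mult_mono norm_weight_le) auto
  moreover have "norm (exp (\<tau> * of_real (ln (2 - x))) * f (farey_right x)) \<le> 101 / 100 * M"
    unfolding norm_mult using assms by (intro mult_mono norm_weight_le) auto
  ultimately have "norm (exp (\<tau> * of_real (ln (1 + x))) * f (farey_left x) +
      exp (\<tau> * of_real (ln (2 - x))) * f (farey_right x)) \<le> 101 / 100 * M + 101 / 100 * M"
    by (rule norm_triangle_mono)
  then show ?thesis
    by (simp add: transfer_def norm_divide)
qed

text \<open>A Lasota-Yorke type inequality. Moving the arguments of \<open>f\<close> costs 101/100
  (the weights) times 5/8 (the average contraction) times \<open>K\<close>; moving the weights costs
  1/100 times \<open>M\<close>.\<close>

lemma lipschitz_on_transfer:
  assumes lip: "K-lipschitz_on {0..1} f" and M: "\<And>x. x \<in> {0..1} \<Longrightarrow> norm (f x) \<le> M"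
  shows "(101 / 160 * K + M / 100)-lipschitz_on {0..1} (transfer \<tau> f)"
proof (rule lipschitz_onI)
  have M0: "0 \<le> M" using M[of 0] order_trans[OF norm_ge_zero[of "f 0"], of M] by simp
  have K0: "0 \<le> K" using lip by (rule lipschitz_on_nonneg)
  show "0 \<le> 101 / 160 * K + M / 100" using M0 K0 by simp
  have branch: "norm (exp (\<tau> * of_real (ln a)) * f u - exp (\<tau> * of_real (ln b)) * f v)
      \<le> 101 / 100 * (K * \<bar>u - v\<bar>) + \<bar>a - b\<bar> / 100 * M"
    if "a \<in> {1..2}" "b \<in> {1..2}" "u \<in> {0..1}" "v \<in> {0..1}" for a b u v
  proof -
    have "exp (\<tau> * of_real (ln a)) * f u - exp (\<tau> * of_real (ln b)) * f v
       = exp (\<tau> * of_real (ln a)) * (f u - f v)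
         + (exp (\<tau> * of_real (ln a)) - exp (\<tau> * of_real (ln b))) * f v"
      by (simp add: algebra_simps)
    moreover have "norm (exp (\<tau> * of_real (ln a)) * (f u - f v)) \<le> 101 / 100 * (K * \<bar>u - v\<bar>)"
      unfolding norm_mult using that lipschitz_on_normD[OF lip, of u v]
      by (intro mult_mono norm_weight_le) auto
    moreover have "norm ((exp (\<tau> * of_real (ln a)) - exp (\<tau> * of_real (ln b))) * f v)
        \<le> \<bar>a - b\<bar> / 100 * M"
      unfolding norm_mult using that by (intro mult_mono weight_lipschitz M) auto
    ultimately show ?thesis by (metis add_mono norm_triangle_le)
  qed
  fix x y :: real assume xy: "x \<in> {0..1}" "y \<in> {0..1}"
  let ?L = "exp (\<tau> * of_real (ln (1 + x))) * f (farey_left x)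
      - exp (\<tau> * of_real (ln (1 + y))) * f (farey_left y)"
  let ?R = "exp (\<tau> * of_real (ln (2 - x))) * f (farey_right x)
      - exp (\<tau> * of_real (ln (2 - y))) * f (farey_right y)"
  have "norm ?L \<le> 101 / 100 * (K * \<bar>farey_left x - farey_left y\<bar>) + \<bar>(1 + x) - (1 + y)\<bar> / 100 * M"
    using xy farey_left_mem by (intro branch) auto
  moreover have "norm ?R \<le> 101 / 100 * (K * \<bar>farey_right x - farey_right y\<bar>) + \<bar>(2 - x) - (2 - y)\<bar> / 100 * M"
    using xy farey_right_mem by (intro branch) auto
  ultimately have "norm (?L + ?R)
      \<le> 101 / 100 * (K * \<bar>farey_left x - farey_left y\<bar>) + \<bar>(1 + x) - (1 + y)\<bar> / 100 * M +
        (101 / 100 * (K * \<bar>farey_right x - farey_right y\<bar>) + \<bar>(2 - x) - (2 - y)\<bar> / 100 * M)"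
    by (rule norm_triangle_mono)
  also have "\<dots> = 101 / 100 * (K * (\<bar>farey_left x - farey_left y\<bar> +
      \<bar>farey_right x - farey_right y\<bar>)) + \<bar>x - y\<bar> / 50 * M"
    by (simp add: algebra_simps abs_minus_commute)
  also have "\<dots> \<le> 101 / 100 * (K * (5 / 4 * \<bar>x - y\<bar>)) + \<bar>x - y\<bar> / 50 * M"
    using K0 farey_average_contraction[OF xy] by (intro add_right_mono mult_left_mono) auto
  finally have "norm (?L + ?R) \<le> 2 * ((101 / 160 * K + M / 100) * \<bar>x - y\<bar>)"
    by (simp add: algebra_simps)
  moreover have "transfer \<tau> f x - transfer \<tau> f y = (?L + ?R) / 2"
    by (simp add: transfer_def field_simps)
  then have "dist (transfer \<tau> f x) (transfer \<tau> f y) = norm (?L + ?R) / 2"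
    by (simp only: dist_norm norm_divide norm_numeral)
  ultimately show "dist (transfer \<tau> f x) (transfer \<tau> f y) \<le> (101 / 160 * K + M / 100) * dist x y"
    by (simp only: dist_real_def)
qed

text \<open>Vanishing at the midpoint bounds \<open>w\<close> by \<open>K / 2\<close>, so the
  Lipschitz constant alone controls everything: 101/160 + 1/200 = 509/800.\<close>

lemma transfer_lipschitz_vanishing:
  assumes lip: "K-lipschitz_on {0..1} w" and "w (1 / 2) = 0"
  shows "(509 / 800 * K)-lipschitz_on {0..1} (transfer \<tau> w)"
    and "norm (transfer \<tau> w (1 / 2)) \<le> 101 / 200 * K"
proof -
  have K0: "0 \<le> K" using lip by (rule lipschitz_on_nonneg)
  have M: "norm (w x) \<le> K / 2" if "x \<in> {0..1}" for x
  proof -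
    have "norm (w x) \<le> K * \<bar>x - 1 / 2\<bar>"
      using lipschitz_on_normD[OF lip that, of "1 / 2"] assms by simp
    also have "\<dots> \<le> K * (1 / 2)"
      using K0 that by (intro mult_left_mono) (auto simp: abs_if)
    finally show ?thesis by simp
  qed
  show "(509 / 800 * K)-lipschitz_on {0..1} (transfer \<tau> w)"
    using lipschitz_on_transfer[OF lip M] by simp
  have "norm (transfer \<tau> w (1 / 2)) \<le> 101 / 100 * (K / 2)"
    by (intro norm_transfer_le M farey_left_mem farey_right_mem) auto
  then show "norm (transfer \<tau> w (1 / 2)) \<le> 101 / 200 * K" by simp
qed

text \<open>Split \<open>h\<close> into 1 and \<open>h - 1\<close>. At the midpoint both weights are
  the same power of 3/2, within 1/100 of 1, and 101/2000 + 1/100 < 1/16.\<close>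

lemma normalized_transfer_norm:
  assumes "normalized h"
  shows "norm (transfer \<tau> h (1 / 2) - 1) \<le> 1 / 16"
proof -
  have lip: "(1 / 10)-lipschitz_on {0..1} (\<lambda>x. h x - 1)"
    using lipschitz_on_diff[OF _ lipschitz_on_constant, of "1 / 10" "{0..1}" h 1] assms
    by (simp add: normalized_def)
  have "norm (transfer \<tau> (\<lambda>x. h x - 1) (1 / 2)) \<le> 101 / 200 * (1 / 10)"
    using assms by (intro transfer_lipschitz_vanishing(2)[OF lip]) (auto simp: normalized_def)
  moreover have "norm (transfer \<tau> (\<lambda>_. 1) (1 / 2) - 1) \<le> 1 / 100"
  proof -
    have "transfer \<tau> (\<lambda>_. 1) (1 / 2) - 1 = exp (\<tau> * of_real (ln (3 / 2))) - 1"
      by (simp add: transfer_def)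
    then show ?thesis using norm_weight_diff_1_le[of "3 / 2"] by simp
  qed
  ultimately have "norm (transfer \<tau> (\<lambda>x. h x - 1) (1 / 2) + (transfer \<tau> (\<lambda>_. 1) (1 / 2) - 1)) \<le> 1 / 16"
    by (intro norm_triangle_le) auto
  then show ?thesis by (simp add: transfer_diff)
qed

lemma normalized_transfer_nz:
  assumes "normalized h"
  shows "norm (transfer \<tau> h (1 / 2)) \<ge> 15 / 16" "transfer \<tau> h (1 / 2) \<noteq> 0"
proof -
  show "norm (transfer \<tau> h (1 / 2)) \<ge> 15 / 16"
    using normalized_transfer_norm[OF assms]
      norm_triangle_ineq2[of 1 "transfer \<tau> h (1 / 2)"] by (simp add: norm_minus_commute)
  then show "transfer \<tau> h (1 / 2) \<noteq> 0" by auto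
qed

text \<open>With \<open>h\<close> bounded by 21/20, the new Lipschitz constant is at most 101/1600 +
  21/2000, which stays below 1/10 after division by 15/16.\<close>

lemma normalized_step:
  assumes "normalized h"
  shows "normalized (\<lambda>x. transfer \<tau> h x / transfer \<tau> h (1 / 2))"
proof -
  have lip: "(1 / 10)-lipschitz_on {0..1} h" and h: "h (1 / 2) = 1"
    using assms by (auto simp: normalized_def)
  have "norm (h x) \<le> 21 / 20" if "x \<in> {0..1}" for x
  proof -
    have "norm (h x - 1) \<le> 1 / 10 * \<bar>x - 1 / 2\<bar>"
      using lipschitz_on_normD[OF lip that, of "1 / 2"] h by simp
    also have "\<dots> \<le> 1 / 20" using that by (auto simp: abs_if)
    finally show ?thesis using norm_triangle_ineq2[of "h x" 1] by simp
  qed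
  from lipschitz_on_transfer[OF lip this]
  have "(1 / 10)-lipschitz_on {0..1} (\<lambda>x. transfer \<tau> h x / transfer \<tau> h (1 / 2))"
    using normalized_transfer_nz(1)[OF assms]
    by (intro lipschitz_on_divide_const[where c = "15 / 16"]) auto
  then show ?thesis
    by (simp add: normalized_def normalized_transfer_nz[OF assms])
qed

text \<open>With \<open>w = h' - h\<close>, the difference of the quotients is \<open>(transfer
  \<tau> w - (p' - p) * (transfer \<tau> h / p)) / p'\<close>. Since \<open>w\<close> vanishes at
  1/2, its Lipschitz constant is at most (509/800 + 101/2000) / (15/16) < 3/4 times
  \<open>K\<close>.\<close>

lemma normalized_step_contraction:
  assumes h: "normalized h" and h': "normalized h'"
    and K: "K-lipschitz_on {0..1} (\<lambda>x. h' x - h x)"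
  shows "(3 / 4 * K)-lipschitz_on {0..1}
           (\<lambda>x. transfer \<tau> h' x / transfer \<tau> h' (1 / 2) - transfer \<tau> h x / transfer \<tau> h (1 / 2))"
    and "norm (transfer \<tau> h' (1 / 2) - transfer \<tau> h (1 / 2)) \<le> K"
proof -
  define w where "w x = h' x - h x" for x
  define p where "p = transfer \<tau> h (1 / 2)"
  define p' where "p' = transfer \<tau> h' (1 / 2)"
  have K0: "0 \<le> K" using K by (rule lipschitz_on_nonneg)
  have w: "K-lipschitz_on {0..1} w" "w (1 / 2) = 0"
    using K h h' by (auto simp: w_def[abs_def] normalized_def)
  have tw: "transfer \<tau> w x = transfer \<tau> h' x - transfer \<tau> h x" for x
    unfolding w_def by (rule transfer_diff)
  note v = transfer_lipschitz_vanishing[OF w]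
  show "norm (transfer \<tau> h' (1 / 2) - transfer \<tau> h (1 / 2)) \<le> K"
    using v(2) K0 by (simp add: tw)
  have nz: "p \<noteq> 0" "p' \<noteq> 0"
    using normalized_transfer_nz[OF h] normalized_transfer_nz[OF h'] by (auto simp: p_def p'_def)
  have step: "(1 / 10)-lipschitz_on {0..1} (\<lambda>x. transfer \<tau> h x / p)"
    using normalized_step[OF h] by (simp add: normalized_def p_def)
  have "(norm (p' - p) * (1 / 10))-lipschitz_on {0..1} (\<lambda>x. (p' - p) * (transfer \<tau> h x / p))"
    by (rule lipschitz_on_mult_const[OF step])
  then have "(509 / 800 * K + norm (p' - p) * (1 / 10))-lipschitz_on {0..1}
      (\<lambda>x. transfer \<tau> w x - (p' - p) * (transfer \<tau> h x / p))"
    by (rule lipschitz_on_diff[OF v(1)])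
  moreover have "norm (p' - p) \<le> 101 / 200 * K"
    using v(2) by (simp add: tw p_def p'_def)
  ultimately have "(3 / 4 * K)-lipschitz_on {0..1}
      (\<lambda>x. (transfer \<tau> w x - (p' - p) * (transfer \<tau> h x / p)) / p')"
    using K0 normalized_transfer_nz[OF h']
    by (intro lipschitz_on_divide_const[where c = "15 / 16"]) (auto simp: p'_def)
  moreover have "(transfer \<tau> w x - (p' - p) * (transfer \<tau> h x / p)) / p'
      = transfer \<tau> h' x / p' - transfer \<tau> h x / p" for x
    using nz by (simp add: tw field_simps)
  ultimately show "(3 / 4 * K)-lipschitz_on {0..1}
           (\<lambda>x. transfer \<tau> h' x / transfer \<tau> h' (1 / 2) - transfer \<tau> h x / transfer \<tau> h (1 / 2))"
    by (simp add: p_def p'_def)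
qed

end

section \<open>Moments and the leading eigenvalue\<close>

definition moment :: "nat \<Rightarrow> complex \<Rightarrow> real \<Rightarrow> complex" where
  "moment k \<tau> = (transfer \<tau> ^^ k) (\<lambda>_. 1)"

lemma moment_0: "moment 0 \<tau> x = 1"
  and moment_Suc: "moment (Suc k) \<tau> x = transfer \<tau> (moment k \<tau>) x"
  by (simp_all add: moment_def)

lemma moment_at_0: "moment k 0 x = 1"
  by (induction k arbitrary: x) (simp_all add: moment_0 moment_Suc transfer_def)

lemma holomorphic_moment: "(\<lambda>\<tau>. moment k \<tau> x) holomorphic_on A"
  by (induction k arbitrary: x)
    (auto simp: moment_0 moment_Suc transfer_def intro!: holomorphic_intros)

section \<open>Sums over dyadic intervals as iterates of the transfer operator\<close>

lemma sum_stern_interval_Suc: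
  fixes F :: "nat \<Rightarrow> 'a::comm_monoid_add"
  shows "(\<Sum>n\<in>stern_interval (Suc k). F n) = (\<Sum>n\<in>stern_interval k. F (2 * n) + F (2 * n + 1))"
proof -
  have "sum F {2 * a..<2 * b} = (\<Sum>n=a..<b. F (2 * n) + F (2 * n + 1))" if "a \<le> b" for a b
    using that
  proof (induction b rule: dec_induct)
    case (step b)
    then show ?case by (simp add: add_ac)
  qed simp
  from this[of "2 ^ k" "2 ^ Suc k"] show ?thesis by (simp add: stern_interval_def)
qed

lemma stern_interval_0: "stern_interval 0 = {1}"
  by (auto simp: stern_interval_def)

lemma stern_interval_pos: "n \<in> stern_interval k \<Longrightarrow> n \<ge> 1"
  using one_le_power[of "2::nat" k] by (auto simp: stern_interval_def)

text \<open>A function of a consecutive pair (a, b), homogeneous of degree \<open>\<tau>\<close>: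
  size enters through a + b, shape through the ratio.\<close>

definition stern_ratio_fun :: "complex \<Rightarrow> (real \<Rightarrow> complex) \<Rightarrow> nat \<Rightarrow> complex" where
  "stern_ratio_fun \<tau> f n =
     exp (\<tau> * of_real (ln (real (stern n + stern (n + 1))))) *
     f (real (stern n) / real (stern n + stern (n + 1)))"

text \<open>The two children of (a, b) have sums 2a + b = (a + b)(1 + x) and a + 2b = (a + b)(2 -
  x), and ratios \<open>farey_left x\<close> and \<open>farey_right x\<close>.\<close>

lemma stern_ratio_fun_double:
  assumes "n \<ge> 1"
  shows "stern_ratio_fun \<tau> f (2 * n) + stern_ratio_fun \<tau> f (2 * n + 1)
    = 2 * stern_ratio_fun \<tau> (transfer \<tau> f) n"
proof -
  define a b where "a = real (stern n)" and "b = real (stern (n + 1))"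
  have pos: "a > 0" "b > 0"
    using stern_pos[of n] stern_pos[of "n + 1"] assms by (auto simp: a_def b_def)
  have s: "stern (2 * n) = stern n" "stern (2 * n + 1) = stern n + stern (n + 1)"
    "stern (2 * n + 1 + 1) = stern (n + 1)"
    using stern_even[of n] stern_odd[of n] stern_even[of "n + 1"] assms by simp_all
  define x where "x = a / (a + b)"
  have l: "1 + x = (a + (a + b)) / (a + b)" and r: "2 - x = (a + b + b) / (a + b)"
    using pos by (simp_all add: x_def field_simps)
  have "farey_left x = a / (a + (a + b))" "farey_right x = (a + b) / (a + b + b)"
    using pos unfolding farey_left_def farey_right_def l r by (simp_all add: x_def)
  moreover have "ln (a + (a + b)) = ln (a + b) + ln (1 + x)" "ln (a + b + b) = ln (a + b) + ln (2 - x)"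
    using pos unfolding l r by (simp_all add: ln_div)
  ultimately have "exp (\<tau> * of_real (ln (a + (a + b)))) * f (a / (a + (a + b)))
      + exp (\<tau> * of_real (ln (a + b + b))) * f ((a + b) / (a + b + b))
      = 2 * (exp (\<tau> * of_real (ln (a + b))) * transfer \<tau> f x)"
    by (simp add: transfer_def exp_add algebra_simps)
  then show ?thesis
    unfolding stern_ratio_fun_def s of_nat_add a_def[symmetric] b_def[symmetric] x_def .
qed

text \<open>The root n = 1 carries the pair (1, 1): its sum gives the factor with
  \<open>ln 2\<close>, its ratio the base point 1/2.\<close>

lemma sum_stern_ratio_fun:
  "(\<Sum>n\<in>stern_interval k. stern_ratio_fun \<tau> f n)
     = 2 ^ k * exp (\<tau> * of_real (ln 2)) * (transfer \<tau> ^^ k) f (1 / 2)"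
proof (induction k arbitrary: f)
  case 0
  have "stern (Suc (Suc 0)) = 1" using stern_even[of 1] stern_1 by (simp add: numeral_2_eq_2)
  then show ?case
    using stern_1 by (simp add: stern_interval_0 stern_ratio_fun_def)
next
  case (Suc k)
  have "(\<Sum>n\<in>stern_interval (Suc k). stern_ratio_fun \<tau> f n)
      = (\<Sum>n\<in>stern_interval k. 2 * stern_ratio_fun \<tau> (transfer \<tau> f) n)"
    unfolding sum_stern_interval_Suc
    by (intro sum.cong refl stern_ratio_fun_double stern_interval_pos)
  also have "\<dots> = 2 * (2 ^ k * exp (\<tau> * of_real (ln 2)) * (transfer \<tau> ^^ k) (transfer \<tau> f) (1 / 2))"
    unfolding sum_distrib_left[symmetric] Suc.IH ..
  finally show ?case
    by (simp add: funpow_swap1)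
qed

lemma stern_moment_eq_sum:
  "stern_moment N \<tau> = (\<Sum>n\<in>stern_interval N. exp (\<tau> * of_real (ln (real (stern n))))) / 2 ^ N"
proof -
  have "card (stern_interval N) = 2 ^ N"
    by (simp add: stern_interval_def)
  then show ?thesis
    unfolding stern_moment_def
    by (subst integral_measure_pmf[of "stern_interval N"])
      (auto simp: stern_interval_finite stern_interval_nonempty set_pmf_of_set pmf_of_set
        scaleR_conv_of_real sum_divide_distrib)
qed

lemma stern_moment_0: "stern_moment 0 \<tau> = 1"
  using stern_1 by (simp add: stern_moment_eq_sum stern_interval_0)

text \<open>Splitting off the even arguments avoids the test function \<open>x powr \<tau>\<close>, which is not Lipschitz
  at 0.\<close>

lemma stern_moment_Suc:
  "stern_moment (Suc N) \<tau> =
     (stern_moment N \<tau> + exp (\<tau> * of_real (ln 2)) * moment N \<tau> (1 / 2)) / 2"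
proof -
  let ?S = "\<Sum>n\<in>stern_interval N. exp (\<tau> * of_real (ln (real (stern n))))"
  have "(\<Sum>n\<in>stern_interval (Suc N). exp (\<tau> * of_real (ln (real (stern n)))))
      = (\<Sum>n\<in>stern_interval N. exp (\<tau> * of_real (ln (real (stern n)))) + stern_ratio_fun \<tau> (\<lambda>_. 1) n)"
    unfolding sum_stern_interval_Suc
  proof (intro sum.cong refl)
    fix n assume "n \<in> stern_interval N"
    then have "n \<ge> 1" by (rule stern_interval_pos)
    then show "exp (\<tau> * of_real (ln (real (stern (2 * n))))) + exp (\<tau> * of_real (ln (real (stern (2 * n + 1)))))
        = exp (\<tau> * of_real (ln (real (stern n)))) + stern_ratio_fun \<tau> (\<lambda>_. 1) n"
      unfolding stern_even[OF \<open>n \<ge> 1\<close>] stern_odd[OF \<open>n \<ge> 1\<close>] by (simp add: stern_ratio_fun_def)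
  qed
  also have "\<dots> = ?S + 2 ^ N * exp (\<tau> * of_real (ln 2)) * moment N \<tau> (1 / 2)"
    by (simp add: sum.distrib sum_stern_ratio_fun moment_def)
  finally show ?thesis
    by (simp add: stern_moment_eq_sum add_divide_distrib)
qed

section \<open>The leading eigenvalue as a limit of normalising factors\<close>

definition growth_ratio :: "nat \<Rightarrow> complex \<Rightarrow> complex" where
  "growth_ratio k \<tau> = moment (Suc k) \<tau> (1 / 2) / moment k \<tau> (1 / 2)"

definition eigenvalue :: "complex \<Rightarrow> complex" where
  "eigenvalue \<tau> = lim (\<lambda>k. growth_ratio k \<tau>)"

definition scaled_moment :: "nat \<Rightarrow> complex \<Rightarrow> complex" where
  "scaled_moment k \<tau> = moment k \<tau> (1 / 2) / eigenvalue \<tau> ^ k"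

definition amplitude :: "complex \<Rightarrow> complex" where
  "amplitude \<tau> = lim (\<lambda>k. scaled_moment k \<tau>)"

definition stern_amplitude :: "complex \<Rightarrow> complex" where
  "stern_amplitude \<tau> = exp (\<tau> * of_real (ln 2)) * amplitude \<tau> / (2 * eigenvalue \<tau> - 1)"

lemma eigenvalue_0: "eigenvalue 0 = 1"
  by (simp add: eigenvalue_def growth_ratio_def moment_at_0)

lemma scaled_moment_0: "scaled_moment k 0 = 1"
  by (simp add: scaled_moment_def moment_at_0 eigenvalue_0)

lemma stern_amplitude_0: "stern_amplitude 0 = 1"
  by (simp add: stern_amplitude_def amplitude_def scaled_moment_0 eigenvalue_0)

context
  fixes \<tau> :: complex
  assumes small: "norm \<tau> \<le> 1 / 200"
begin

text \<open>The two claims need each other: nonvanishing makes the quotient meaningful, and the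
  quotient being normalised keeps the next moment away from 0.\<close>

lemma moment_nz_normalized:
  "moment k \<tau> (1 / 2) \<noteq> 0 \<and> normalized (\<lambda>x. moment k \<tau> x / moment k \<tau> (1 / 2))"
proof (induction k)
  case 0
  then show ?case
    by (auto simp: moment_0 normalized_def intro: lipschitz_on_le[OF lipschitz_on_constant])
next
  case (Suc k)
  define h where "h x = moment k \<tau> x / moment k \<tau> (1 / 2)" for x
  have h: "normalized h" and nz: "moment k \<tau> (1 / 2) \<noteq> 0"
    using Suc by (simp_all add: h_def[abs_def])
  have th: "transfer \<tau> h x = moment (Suc k) \<tau> x / moment k \<tau> (1 / 2)" for x
    unfolding h_def by (simp add: transfer_divide moment_Suc)
  have "moment (Suc k) \<tau> (1 / 2) \<noteq> 0"
    using normalized_transfer_nz(2)[OF small h] by (auto simp: th)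
  with normalized_step[OF small h] nz show ?case by (simp add: th)
qed

lemmas moment_nz = moment_nz_normalized[THEN conjunct1]
lemmas moment_normalized = moment_nz_normalized[THEN conjunct2]

lemma growth_ratio_eq_transfer:
  "transfer \<tau> (\<lambda>x. moment k \<tau> x / moment k \<tau> (1 / 2)) (1 / 2) = growth_ratio k \<tau>"
  by (simp add: growth_ratio_def transfer_divide moment_Suc)

lemma moment_lipschitz_contraction:
  "(1 / 10 * (3 / 4) ^ k)-lipschitz_on {0..1}
     (\<lambda>x. moment (Suc k) \<tau> x / moment (Suc k) \<tau> (1 / 2) - moment k \<tau> x / moment k \<tau> (1 / 2))"
proof (induction k)
  case 0
  have "(1 / 10 + 0)-lipschitz_on {0..1} (\<lambda>x. moment (Suc 0) \<tau> x / moment (Suc 0) \<tau> (1 / 2) - 1)"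
    using moment_normalized[of "Suc 0"]
    by (intro lipschitz_on_diff lipschitz_on_constant) (simp add: normalized_def)
  then show ?case by (simp add: moment_0)
next
  case (Suc k)
  have eq: "transfer \<tau> (\<lambda>x. moment j \<tau> x / moment j \<tau> (1 / 2)) x /
      transfer \<tau> (\<lambda>x. moment j \<tau> x / moment j \<tau> (1 / 2)) (1 / 2)
      = moment (Suc j) \<tau> x / moment (Suc j) \<tau> (1 / 2)" for j x
    using moment_nz by (simp add: transfer_divide moment_Suc)
  show ?case
    using normalized_step_contraction(1)[OF small moment_normalized moment_normalized Suc.IH]
    unfolding eq by (simp add: mult_ac)
qed

lemma norm_growth_ratio_diff_1_le: "norm (growth_ratio k \<tau> - 1) \<le> 1 / 16"
  using normalized_transfer_norm[OF small moment_normalized] by (simp add: growth_ratio_eq_transfer)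

lemma norm_growth_ratio_step_le:
  "norm (growth_ratio (Suc k) \<tau> - growth_ratio k \<tau>) \<le> 1 / 10 * (3 / 4) ^ k"
  using normalized_step_contraction(2)[OF small moment_normalized moment_normalized
      moment_lipschitz_contraction]
  unfolding growth_ratio_eq_transfer .

lemma norm_growth_ratio_diff_eigenvalue_le:
  "norm (growth_ratio k \<tau> - eigenvalue \<tau>) \<le> 2 / 5 * (3 / 4) ^ k"
  using norm_diff_le_geometric_limit[OF norm_growth_ratio_step_le, of k]
  by (simp add: eigenvalue_def)

lemma norm_eigenvalue_diff_1_le: "norm (eigenvalue \<tau> - 1) \<le> 1 / 8"
proof -
  have "norm (eigenvalue \<tau> - 1) \<le> norm (eigenvalue \<tau> - growth_ratio 8 \<tau>) + norm (growth_ratio 8 \<tau> - 1)"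
    using norm_triangle_ineq[of "eigenvalue \<tau> - growth_ratio 8 \<tau>" "growth_ratio 8 \<tau> - 1"] by simp
  \<comment> \<open>Index 8 is large enough for the first term to be below 1/16.\<close>
  also have "\<dots> \<le> 2 / 5 * (3 / 4) ^ 8 + 1 / 16"
    using norm_growth_ratio_diff_eigenvalue_le[of 8] norm_growth_ratio_diff_1_le[of 8]
    by (intro add_mono) (simp_all add: norm_minus_commute)
  also have "\<dots> \<le> 1 / 8"
    by (simp add: power_divide)
  finally show ?thesis .
qed

lemma norm_eigenvalue_ge: "norm (eigenvalue \<tau>) \<ge> 7 / 8"
  using norm_eigenvalue_diff_1_le norm_triangle_ineq2[of 1 "eigenvalue \<tau>"]
  by (simp add: norm_minus_commute)

lemma eigenvalue_nz: "eigenvalue \<tau> \<noteq> 0" "2 * eigenvalue \<tau> - 1 \<noteq> 0"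
proof -
  show "eigenvalue \<tau> \<noteq> 0" using norm_eigenvalue_ge by auto
  show "2 * eigenvalue \<tau> - 1 \<noteq> 0"
  proof
    assume "2 * eigenvalue \<tau> - 1 = 0"
    then have "norm (2 * eigenvalue \<tau>) = 1" by simp
    then show False using norm_eigenvalue_ge by (simp add: norm_mult)
  qed
qed

lemma scaled_moment_Suc_diff:
  "scaled_moment (Suc k) \<tau> - scaled_moment k \<tau>
     = scaled_moment k \<tau> * ((growth_ratio k \<tau> - eigenvalue \<tau>) / eigenvalue \<tau>)"
  using moment_nz[of k] eigenvalue_nz(1)
  by (simp add: scaled_moment_def growth_ratio_def field_simps)

lemma norm_relative_growth_le:
  "norm ((growth_ratio k \<tau> - eigenvalue \<tau>) / eigenvalue \<tau>) \<le> 1 / 2 * (3 / 4) ^ k"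
proof -
  have "norm ((growth_ratio k \<tau> - eigenvalue \<tau>) / eigenvalue \<tau>) \<le> 2 / 5 * (3 / 4) ^ k / (7 / 8)"
    unfolding norm_divide
    using norm_growth_ratio_diff_eigenvalue_le norm_eigenvalue_ge by (intro frac_le) auto
  also have "\<dots> \<le> 1 / 2 * (3 / 4) ^ k" by simp
  finally show ?thesis .
qed

text \<open>The scaled moment is a product of factors 1 + q with geometrically small q. A bound
  uniform in \<open>k\<close> and \<open>\<tau>\<close> serves both the convergence to
  \<open>amplitude\<close> and the Cauchy estimates for the variance.\<close>

lemma norm_scaled_moment_le: "norm (scaled_moment k \<tau>) \<le> exp 2"
proof -
  \<comment> \<open>The exponent is the partial sum of the series of 1/2 * (3/4)^i.\<close>
  have "norm (scaled_moment k \<tau>) \<le> exp (2 * (1 - (3 / 4) ^ k))"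
  proof (induction k)
    case (Suc k)
    let ?q = "(growth_ratio k \<tau> - eigenvalue \<tau>) / eigenvalue \<tau>"
    have "scaled_moment (Suc k) \<tau> = scaled_moment k \<tau> * (1 + ?q)"
      using scaled_moment_Suc_diff[of k] by (simp add: algebra_simps)
    then have "norm (scaled_moment (Suc k) \<tau>) = norm (scaled_moment k \<tau>) * norm (1 + ?q)"
      by (simp add: norm_mult)
    also have "norm (1 + ?q) \<le> 1 + 1 / 2 * (3 / 4) ^ k"
      using norm_relative_growth_le by (intro norm_triangle_le) auto
    also have "\<dots> \<le> exp (1 / 2 * (3 / 4) ^ k)"
      by (rule exp_ge_add_one_self)
    finally have "norm (scaled_moment (Suc k) \<tau>)
        \<le> exp (2 * (1 - (3 / 4) ^ k)) * exp (1 / 2 * (3 / 4) ^ k)"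
      using Suc.IH by (simp add: mult_mono order_trans[OF _ mult_right_mono] mult_left_mono)
    also have "\<dots> = exp (2 * (1 - (3 / 4) ^ Suc k))"
      by (simp add: exp_add[symmetric] algebra_simps)
    finally show ?case .
  qed (simp add: scaled_moment_def moment_0)
  also have "\<dots> \<le> exp 2" by simp
  finally show ?thesis .
qed

lemma norm_scaled_moment_step_le:
  "norm (scaled_moment (Suc k) \<tau> - scaled_moment k \<tau>) \<le> exp 2 / 2 * (3 / 4) ^ k"
proof -
  have "norm (scaled_moment (Suc k) \<tau> - scaled_moment k \<tau>) \<le> exp 2 * (1 / 2 * (3 / 4) ^ k)"
    unfolding scaled_moment_Suc_diff norm_mult[of "scaled_moment k \<tau>"]
    by (intro mult_mono norm_scaled_moment_le norm_relative_growth_le) auto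
  then show ?thesis by simp
qed

lemma norm_scaled_moment_diff_amplitude_le:
  "norm (scaled_moment k \<tau> - amplitude \<tau>) \<le> 2 * exp 2 * (3 / 4) ^ k"
  using norm_diff_le_geometric_limit[OF norm_scaled_moment_step_le, of k]
  by (simp add: amplitude_def)

text \<open>The limit \<open>stern_amplitude \<tau>\<close> is the fixed point of the affine recursion for
  \<open>stern_moment N \<tau> / eigenvalue \<tau> ^ N\<close>.\<close>

lemma norm_stern_moment_diff_amplitude_le:
  assumes "norm (stern_amplitude \<tau> - 1) \<le> 1 / 2"
  shows "norm (stern_moment N \<tau> / eigenvalue \<tau> ^ N - stern_amplitude \<tau>) \<le> 7 * exp 2 * (3 / 4) ^ N"
proof (induction N)
  case 0
  have "(1::real) \<le> exp 2" by simp
  then have "norm (stern_amplitude \<tau> - 1) \<le> 7 * exp 2"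
    using assms by linarith
  then show ?case by (simp add: stern_moment_0 norm_minus_commute)
next
  case (Suc N)
  define e where "e = exp (\<tau> * of_real (ln 2))"
  define m where "m = stern_moment N \<tau> / eigenvalue \<tau> ^ N"
  have fix_point: "stern_amplitude \<tau> = (stern_amplitude \<tau> + e * amplitude \<tau>) / (2 * eigenvalue \<tau>)"
  proof -
    have "stern_amplitude \<tau> * (2 * eigenvalue \<tau> - 1) = e * amplitude \<tau>"
      using eigenvalue_nz by (simp add: stern_amplitude_def e_def)
    then have "stern_amplitude \<tau> * (2 * eigenvalue \<tau>) = stern_amplitude \<tau> + e * amplitude \<tau>"
      by (simp add: algebra_simps)
    then show ?thesis using eigenvalue_nz by (simp add: field_simps)
  qed
  have "stern_moment (Suc N) \<tau> / eigenvalue \<tau> ^ Suc N = (m + e * scaled_moment N \<tau>) / (2 * eigenvalue \<tau>)"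
    using eigenvalue_nz
    by (simp add: stern_moment_Suc m_def e_def scaled_moment_def field_simps)
  then have "stern_moment (Suc N) \<tau> / eigenvalue \<tau> ^ Suc N - stern_amplitude \<tau>
      = ((m + e * scaled_moment N \<tau>) - (stern_amplitude \<tau> + e * amplitude \<tau>)) / (2 * eigenvalue \<tau>)"
    by (metis diff_divide_distrib fix_point)
  also have "\<dots> = ((m - stern_amplitude \<tau>) + e * (scaled_moment N \<tau> - amplitude \<tau>)) / (2 * eigenvalue \<tau>)"
    by (simp add: algebra_simps)
  finally have eq: "stern_moment (Suc N) \<tau> / eigenvalue \<tau> ^ Suc N - stern_amplitude \<tau> = \<dots>" .
  have "norm e \<le> 101 / 100"
    unfolding e_def by (rule norm_weight_le[OF small]) simp
  then have "norm (e * (scaled_moment N \<tau> - amplitude \<tau>)) \<le> 101 / 100 * (2 * exp 2 * (3 / 4) ^ N)"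
    unfolding norm_mult by (intro mult_mono norm_scaled_moment_diff_amplitude_le) auto
  with Suc.IH have "norm ((m - stern_amplitude \<tau>) + e * (scaled_moment N \<tau> - amplitude \<tau>))
      \<le> 7 * exp 2 * (3 / 4) ^ N + 101 / 100 * (2 * exp 2 * (3 / 4) ^ N)"
    unfolding m_def by (rule norm_triangle_mono)
  \<comment> \<open>The denominator 7/4 is twice the lower bound for the eigenvalue. The constant 7
    closes the induction: (7 + 2.02) / (7/4) <= 7 * 3/4.\<close>
  then have "norm (stern_moment (Suc N) \<tau> / eigenvalue \<tau> ^ Suc N - stern_amplitude \<tau>)
      \<le> (7 * exp 2 * (3 / 4) ^ N + 101 / 100 * (2 * exp 2 * (3 / 4) ^ N)) / (7 / 4)"
    unfolding eq norm_divide[of _ "2 * eigenvalue \<tau>"]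
    using norm_eigenvalue_ge by (intro frac_le) (auto simp: norm_mult)
  also have "\<dots> \<le> 7 * exp 2 * (3 / 4) ^ Suc N"
    by simp
  finally show ?case .
qed

end

section \<open>Holomorphy of the eigenvalue and the amplitudes\<close>

lemma holomorphic_eigenvalue: "eigenvalue holomorphic_on ball 0 (1 / 200)"
proof -
  have "(\<lambda>\<tau>. lim (\<lambda>k. growth_ratio k \<tau>)) holomorphic_on ball 0 (1 / 200)"
  proof (rule holomorphic_on_geometric_limit)
    show "growth_ratio k holomorphic_on ball 0 (1 / 200)" for k
      unfolding growth_ratio_def[abs_def]
      by (intro holomorphic_intros holomorphic_moment moment_nz) auto
    show "norm (growth_ratio (Suc k) \<tau> - growth_ratio k \<tau>) \<le> 1 / 10 * (3 / 4) ^ k"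
      if "\<tau> \<in> ball 0 (1 / 200)" for k \<tau>
      using that by (intro norm_growth_ratio_step_le) auto
  qed auto
  then show ?thesis by (simp add: eigenvalue_def[abs_def])
qed

lemma holomorphic_scaled_moment: "scaled_moment k holomorphic_on ball 0 (1 / 200)"
  unfolding scaled_moment_def[abs_def]
  by (intro holomorphic_intros holomorphic_moment holomorphic_eigenvalue) (auto simp: eigenvalue_nz)

lemma holomorphic_stern_amplitude: "stern_amplitude holomorphic_on ball 0 (1 / 200)"
proof -
  have "(\<lambda>\<tau>. lim (\<lambda>k. scaled_moment k \<tau>)) holomorphic_on ball 0 (1 / 200)"
  proof (rule holomorphic_on_geometric_limit)
    show "norm (scaled_moment (Suc k) \<tau> - scaled_moment k \<tau>) \<le> exp 2 / 2 * (3 / 4) ^ k"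
      if "\<tau> \<in> ball 0 (1 / 200)" for k \<tau>
      using that by (intro norm_scaled_moment_step_le) auto
  qed (auto intro: holomorphic_scaled_moment)
  then have "amplitude holomorphic_on ball 0 (1 / 200)"
    by (simp add: amplitude_def[abs_def])
  then show ?thesis
    unfolding stern_amplitude_def[abs_def]
    by (intro holomorphic_intros holomorphic_eigenvalue eigenvalue_nz(2)) auto
qed

section \<open>Growth of the variance\<close>

primrec mean :: "nat \<Rightarrow> real \<Rightarrow> real" where
  "mean 0 x = 0"
| "mean (Suc k) x =
     (ln (1 + x) + mean k (farey_left x) + (ln (2 - x) + mean k (farey_right x))) / 2"

primrec mean_square :: "nat \<Rightarrow> real \<Rightarrow> real" where
  "mean_square 0 x = 0"
| "mean_square (Suc k) x =
     ((ln (1 + x))\<^sup>2 + 2 * ln (1 + x) * mean k (farey_left x) + mean_square k (farey_left x) +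
      ((ln (2 - x))\<^sup>2 + 2 * ln (2 - x) * mean k (farey_right x) + mean_square k (farey_right x))) / 2"

definition log_variance :: "nat \<Rightarrow> real \<Rightarrow> real" where
  "log_variance k x = mean_square k x - (mean k x)\<^sup>2"

text \<open>\<open>mean\<close> and \<open>mean_square\<close> are the first two moments of the logarithmic growth in \<open>k\<close> random
  steps from ratio \<open>x\<close>, that is, the first two derivatives of \<open>moment k\<close> at \<open>\<tau> = 0\<close>.\<close>

definition branch_gap :: "nat \<Rightarrow> real \<Rightarrow> real" where
  "branch_gap k x = ln (1 + x) + mean k (farey_left x) - (ln (2 - x) + mean k (farey_right x))"

text \<open>Law of total variance for the first step: a fair choice between two conditional means
  has variance a quarter of the squared gap.\<close>

lemma log_variance_Suc:
  "log_variance (Suc k) x =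
     (log_variance k (farey_left x) + log_variance k (farey_right x)) / 2 + (branch_gap k x)\<^sup>2 / 4"
  by (simp add: log_variance_def branch_gap_def power2_eq_square field_simps)

text \<open>The logarithms of the first step cancel in the increment, so it is an average of
  increments at the images. The base case rests on (1 + x)(2 - x) >= 2.\<close>

lemma mean_Suc_diff_ge:
  assumes "x \<in> {0..1}"
  shows "mean (Suc k) x - mean k x \<ge> ln 2 / 2"
  using assms
proof (induction k arbitrary: x)
  case 0
  have "(1 + x) * (2 - x) - 2 = x * (1 - x)" by algebra
  moreover have "x * (1 - x) \<ge> 0" using 0 by simp
  ultimately have "ln 2 \<le> ln ((1 + x) * (2 - x))" by simp
  also have "\<dots> = ln (1 + x) + ln (2 - x)"
    using 0 by (intro ln_mult_pos) auto
  finally show ?case by simp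
next
  case (Suc k)
  have "mean (Suc (Suc k)) x - mean (Suc k) x =
      ((mean (Suc k) (farey_left x) - mean k (farey_left x)) +
       (mean (Suc k) (farey_right x) - mean k (farey_right x))) / 2"
    by (simp only: mean.simps(2)[of "Suc k"] mean.simps(2)[of k x]) (simp add: field_simps)
  then show ?case
    using Suc.IH[OF farey_left_mem[OF Suc.prems]] Suc.IH[OF farey_right_mem[OF Suc.prems]] by argo
qed

text \<open>One step turns a Lipschitz constant K into 1 + 5/8 K, whose fixed point is 8/3.\<close>

lemma mean_lipschitz: "(8 / 3)-lipschitz_on {0..1} (mean k)"
proof (induction k)
  case 0
  then show ?case
    by (auto intro!: lipschitz_onI)
next
  case (Suc k)
  show ?case
  proof (rule lipschitz_onI)
    fix x y :: real assume xy: "x \<in> {0..1}" "y \<in> {0..1}"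
    have l: "\<bar>mean k (farey_left x) - mean k (farey_left y)\<bar> \<le> 8 / 3 * \<bar>farey_left x - farey_left y\<bar>"
      using lipschitz_on_normD[OF Suc] farey_left_mem xy by (metis real_norm_def)
    have r: "\<bar>mean k (farey_right x) - mean k (farey_right y)\<bar> \<le> 8 / 3 * \<bar>farey_right x - farey_right y\<bar>"
      using lipschitz_on_normD[OF Suc] farey_right_mem xy by (metis real_norm_def)
    have "\<bar>ln (1 + x) - ln (1 + y)\<bar> \<le> \<bar>x - y\<bar>" "\<bar>ln (2 - x) - ln (2 - y)\<bar> \<le> \<bar>x - y\<bar>"
      using abs_ln_diff_le[of "1 + x" "1 + y"] abs_ln_diff_le[of "2 - x" "2 - y"] xy by auto
    with l r farey_average_contraction[OF xy]
    have "\<bar>mean (Suc k) x - mean (Suc k) y\<bar> \<le> 8 / 3 * \<bar>x - y\<bar>"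
      unfolding mean.simps by argo
    then show "dist (mean (Suc k) x) (mean (Suc k) y) \<le> 8 / 3 * dist x y"
      by (simp only: dist_real_def)
  qed simp
qed

text \<open>The left branch fixes 0 with zero growth, so the gap there is minus twice an increment
  of \<open>mean\<close>, hence at most \<open>- ln 2\<close>. Lipschitz continuity extends this to
  nearby points.\<close>

lemma branch_gap_sq_ge:
  assumes "x \<in> {0..1 / 64}"
  shows "(branch_gap k x)\<^sup>2 / 4 \<ge> 1 / 16"
proof -
  have x: "x \<in> {0..1}" and "(0::real) \<in> {0..1}" using assms by auto
  have "branch_gap k 0 = 2 * (mean k 0 - mean (Suc k) 0)"
    by (simp add: branch_gap_def farey_left_def field_simps)
  then have at_0: "branch_gap k 0 \<le> - ln 2"
    using mean_Suc_diff_ge[OF \<open>0 \<in> {0..1}\<close>, of k] by argo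
  have l: "\<bar>mean k (farey_left x) - mean k (farey_left 0)\<bar> \<le> 8 / 3 * \<bar>farey_left x - farey_left 0\<bar>"
    using lipschitz_on_normD[OF mean_lipschitz] farey_left_mem x \<open>0 \<in> {0..1}\<close> by (metis real_norm_def)
  have r: "\<bar>mean k (farey_right x) - mean k (farey_right 0)\<bar> \<le> 8 / 3 * \<bar>farey_right x - farey_right 0\<bar>"
    using lipschitz_on_normD[OF mean_lipschitz] farey_right_mem x \<open>0 \<in> {0..1}\<close> by (metis real_norm_def)
  have "\<bar>ln (1 + x) - ln (1 + 0)\<bar> \<le> \<bar>x - 0\<bar>" "\<bar>ln (2 - x) - ln (2 - 0)\<bar> \<le> \<bar>x - 0\<bar>"
    using abs_ln_diff_le[of "1 + x" "1 + 0"] abs_ln_diff_le[of "2 - x" "2 - 0"] x by auto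
  with l r farey_average_contraction[OF x \<open>0 \<in> {0..1}\<close>]
  have "\<bar>branch_gap k x - branch_gap k 0\<bar> \<le> 16 / 3 * \<bar>x - 0\<bar>"
    unfolding branch_gap_def by argo
  \<comment> \<open>The gap changes by at most 16/3 * 1/64 = 1/12 from a value of at most
    -2/3.\<close>
  with at_0 ln2_ge_two_thirds assms have "branch_gap k x \<le> - (1 / 2)"
    by (simp add: abs_if split: if_splits)
  then have "(1 / 2)\<^sup>2 \<le> (- branch_gap k x)\<^sup>2"
    by (intro power_mono) auto
  then show ?thesis by (simp add: power2_eq_square)
qed

lemma log_variance_ge_step:
  assumes lower: "\<And>x. x \<in> {0..1} \<Longrightarrow> log_variance k x \<ge> v" and "x \<in> {0..1}"
  shows "log_variance (Suc k) x \<ge> v"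
  using lower[OF farey_left_mem[OF assms(2)]] lower[OF farey_right_mem[OF assms(2)]]
  by (simp add: log_variance_Suc add_increasing2)

lemma log_variance_ge_add:
  assumes "\<And>x. x \<in> {0..1} \<Longrightarrow> log_variance k x \<ge> v" and "x \<in> {0..1}"
  shows "log_variance (j + k) x \<ge> v"
  using assms(2)
proof (induction j arbitrary: x)
  case (Suc j)
  then show ?case using log_variance_ge_step[of v "j + k" x] by simp
qed (use assms in simp)

text \<open>After \<open>j\<close> left branches \<open>x\<close> has moved to \<open>x / (1 + j * x)\<close>; close to the parabolic fixed
  point 0 the gap between the branches is bounded away from 0, which gains variance.\<close>

lemma log_variance_gain:
  assumes lower: "\<And>x. x \<in> {0..1} \<Longrightarrow> log_variance k x \<ge> v"
    and "x \<in> {0..1}" "x / (1 + real j * x) \<le> 1 / 64"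
  shows "log_variance (j + Suc k) x \<ge> v + 1 / 16 / 2 ^ j"
  using assms(2,3)
proof (induction j arbitrary: x)
  case 0
  then have "x \<in> {0..1 / 64}" by simp
  from branch_gap_sq_ge[OF this, of k] lower[OF farey_left_mem[OF 0(1)]] lower[OF farey_right_mem[OF 0(1)]]
  show ?case unfolding log_variance_Suc add_0 power_0 by argo
next
  case (Suc j)
  note l = farey_left_mem[OF Suc.prems(1)]
  define e :: real where "e = 1 / 16 / 2 ^ j"
  have "farey_left x / (1 + real j * farey_left x) = x / (1 + real (Suc j) * x)"
  proof -
    have "1 + real j * farey_left x = (1 + real (Suc j) * x) / (1 + x)"
      using Suc.prems(1) by (simp add: farey_left_def field_simps)
    then show ?thesis using Suc.prems(1) by (simp add: farey_left_def)
  qed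
  then have "log_variance (j + Suc k) (farey_left x) \<ge> v + e"
    unfolding e_def using Suc.prems(2) by (intro Suc.IH[OF l]) simp
  moreover have "log_variance (j + Suc k) (farey_right x) \<ge> v"
    using log_variance_ge_add[OF lower farey_right_mem[OF Suc.prems(1)], of "Suc j"] by simp
  \<comment> \<open>Only the left branch is credited with the gain, so each step away from 0 halves
    it.\<close>
  ultimately have "v + e / 2 \<le> log_variance (Suc (j + Suc k)) x"
    using zero_le_power2[of "branch_gap (j + Suc k) x"]
    unfolding log_variance_Suc[of "j + Suc k"] by argo
  then show ?case by (simp add: e_def)
qed

lemma log_variance_unbounded: "\<exists>k. log_variance k (1 / 2) > B"
proof -
  \<comment> \<open>Since x / (1 + 64 x) <= 1/64 on the whole interval, 64 left steps suffice from
    any start, and every 65 further steps add \<open>c\<close>.\<close>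
  define c :: real where "c = 1 / 16 / 2 ^ 64"
  have "\<exists>k. \<forall>x\<in>{0..1}. log_variance k x \<ge> real n * c" for n
  proof (induction n)
    case 0
    have "\<forall>x\<in>{0..1}. log_variance 0 x \<ge> real 0 * c"
      by (simp add: log_variance_def)
    then show ?case ..
  next
    case (Suc n)
    then obtain k where k: "\<And>x. x \<in> {0..1} \<Longrightarrow> log_variance k x \<ge> real n * c" by blast
    have "log_variance (64 + Suc k) x \<ge> real n * c + c" if "x \<in> {0..1}" for x
      unfolding c_def using that
      by (intro log_variance_gain[OF k, unfolded c_def]) (auto simp: divide_simps)
    then have "\<forall>x\<in>{0..1}. log_variance (64 + Suc k) x \<ge> real (Suc n) * c"
      by (simp add: algebra_simps)
    then show ?case ..
  qed
  moreover obtain n where "real n * c > B"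
    using reals_Archimedean3[of c] by (auto simp: c_def)
  moreover have "(1 / 2 :: real) \<in> {0..1}" by simp
  ultimately show ?thesis by (meson less_le_trans)
qed

section \<open>Derivatives and cumulants at the origin\<close>

lemma moment_has_deriv:
  "((\<lambda>\<tau>. moment k \<tau> x) has_field_derivative deriv (\<lambda>\<tau>. moment k \<tau> x) z) (at z)"
  "(deriv (\<lambda>\<tau>. moment k \<tau> x) has_field_derivative deriv (deriv (\<lambda>\<tau>. moment k \<tau> x)) z) (at z)"
proof -
  show "((\<lambda>\<tau>. moment k \<tau> x) has_field_derivative deriv (\<lambda>\<tau>. moment k \<tau> x) z) (at z)"
    by (rule holomorphic_derivI[OF holomorphic_moment[of k x UNIV]]) auto
  show "(deriv (\<lambda>\<tau>. moment k \<tau> x) has_field_derivative deriv (deriv (\<lambda>\<tau>. moment k \<tau> x)) z) (at z)"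
    by (rule holomorphic_derivI[of _ UNIV]) (auto intro!: holomorphic_deriv holomorphic_moment)
qed

lemma deriv_moment_Suc:
  "deriv (\<lambda>\<tau>. moment (Suc k) \<tau> x) = (\<lambda>\<tau>.
     (exp (\<tau> * of_real (ln (1 + x))) * (of_real (ln (1 + x)) * moment k \<tau> (farey_left x) +
        deriv (\<lambda>\<tau>. moment k \<tau> (farey_left x)) \<tau>) +
      exp (\<tau> * of_real (ln (2 - x))) * (of_real (ln (2 - x)) * moment k \<tau> (farey_right x) +
        deriv (\<lambda>\<tau>. moment k \<tau> (farey_right x)) \<tau>)) / 2)"
  unfolding moment_Suc transfer_def
  by (intro ext DERIV_imp_deriv)
    (auto intro!: derivative_eq_intros moment_has_deriv(1) simp: algebra_simps)

lemma deriv2_moment_Suc_at_0: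
  "deriv (deriv (\<lambda>\<tau>. moment (Suc k) \<tau> x)) 0 =
     ((of_real (ln (1 + x)))\<^sup>2 + 2 * of_real (ln (1 + x)) * deriv (\<lambda>\<tau>. moment k \<tau> (farey_left x)) 0 +
        deriv (deriv (\<lambda>\<tau>. moment k \<tau> (farey_left x))) 0 +
      ((of_real (ln (2 - x)))\<^sup>2 + 2 * of_real (ln (2 - x)) * deriv (\<lambda>\<tau>. moment k \<tau> (farey_right x)) 0 +
        deriv (deriv (\<lambda>\<tau>. moment k \<tau> (farey_right x))) 0)) / 2"
  unfolding deriv_moment_Suc
  by (rule DERIV_imp_deriv)
    (auto intro!: derivative_eq_intros moment_has_deriv
      simp: moment_at_0 power2_eq_square algebra_simps)

lemma deriv_moment_at_0: "deriv (\<lambda>\<tau>. moment k \<tau> x) 0 = of_real (mean k x)"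
  by (induction k arbitrary: x) (simp_all add: moment_0 deriv_moment_Suc moment_at_0)

lemma deriv2_moment_at_0: "deriv (deriv (\<lambda>\<tau>. moment k \<tau> x)) 0 = of_real (mean_square k x)"
  by (induction k arbitrary: x) (simp_all add: moment_0 deriv2_moment_Suc_at_0 deriv_moment_at_0)

text \<open>For a function with value 1 at 0, the left side is the second derivative of its
  logarithm, which is additive over products. Differentiating the product directly avoids choosing a
  logarithm of \<open>f\<close>.\<close>

lemma second_cumulant_mult_exp:
  fixes f U G :: "complex \<Rightarrow> complex"
  assumes f: "f holomorphic_on S" and U: "U holomorphic_on S" and S: "open S" "0 \<in> S"
    and G: "\<And>z. z \<in> S \<Longrightarrow> G z = f z * exp (a * U z)" and "f 0 = 1" "U 0 = 0"
  shows "deriv (deriv G) 0 - (deriv G 0)\<^sup>2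
    = deriv (deriv f) 0 - (deriv f 0)\<^sup>2 + a * deriv (deriv U) 0"
proof -
  note d = holomorphic_derivI[OF f S(1)] holomorphic_derivI[OF U S(1)]
    holomorphic_derivI[OF holomorphic_deriv[OF f S(1)] S(1)]
    holomorphic_derivI[OF holomorphic_deriv[OF U S(1)] S(1)]
  have near: "\<forall>\<^sub>F z in nhds w. z \<in> S" if "w \<in> S" for w
    using S that by (intro eventually_nhds_in_open)
  define G1 where "G1 z = exp (a * U z) * (deriv f z + f z * (a * deriv U z))" for z
  have G1: "deriv G w = G1 w" if w: "w \<in> S" for w
  proof -
    have "deriv G w = deriv (\<lambda>z. f z * exp (a * U z)) w"
      using near[OF w] by (intro deriv_cong_ev) (auto elim: eventually_mono simp: G)
    also have "\<dots> = G1 w"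
      unfolding G1_def
      by (rule DERIV_imp_deriv)
        (use w in \<open>auto intro!: derivative_eq_intros d(1,2) simp: algebra_simps\<close>)
    finally show ?thesis .
  qed
  have "deriv (deriv G) 0 = deriv G1 0"
    using near[OF S(2)] by (intro deriv_cong_ev) (auto elim: eventually_mono simp: G1)
  also have "\<dots> = deriv (deriv f) 0 + 2 * (deriv f 0 * (a * deriv U 0)) + a * deriv (deriv U) 0
      + (a * deriv U 0)\<^sup>2"
    unfolding G1_def[abs_def]
    by (rule DERIV_imp_deriv)
      (use S assms in \<open>auto intro!: derivative_eq_intros d simp: algebra_simps power2_eq_square\<close>)
  finally show ?thesis
    using G1[OF S(2)] assms by (simp add: G1_def power2_eq_square algebra_simps)
qed

text \<open>Cauchy's estimate on a disc of half the radius of holomorphy; the bound is independent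
  of \<open>k\<close>.\<close>

lemma norm_scaled_moment_deriv_le:
  "norm ((deriv ^^ n) (scaled_moment k) 0) \<le> fact n * exp 2 / (1 / 400) ^ n"
proof (rule Cauchy_inequality)
  have sub: "cball 0 (1 / 400 :: real) \<subseteq> ball (0::complex) (1 / 200)" by auto
  show "scaled_moment k holomorphic_on ball 0 (1 / 400)"
    by (rule holomorphic_on_subset[OF holomorphic_scaled_moment]) auto
  show "continuous_on (cball 0 (1 / 400)) (scaled_moment k)"
    by (rule continuous_on_subset[OF holomorphic_on_imp_continuous_on[OF holomorphic_scaled_moment] sub])
qed (auto intro!: norm_scaled_moment_le)

section \<open>The quasi-power expansion\<close>

definition log_eigenvalue :: "complex \<Rightarrow> complex" where
  "log_eigenvalue \<tau> = Ln (eigenvalue \<tau>)"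

lemma not_in_nonpos_Reals_near_1:
  fixes z :: complex
  assumes "norm (z - 1) < 1"
  shows "z \<notin> \<real>\<^sub>\<le>\<^sub>0"
proof
  assume "z \<in> \<real>\<^sub>\<le>\<^sub>0"
  then have "Re z \<le> 0" by (simp add: complex_nonpos_Reals_iff)
  moreover have "\<bar>Re (z - 1)\<bar> < 1" using abs_Re_le_cmod[of "z - 1"] assms by linarith
  ultimately show False by simp
qed

lemma holomorphic_log_eigenvalue: "log_eigenvalue holomorphic_on ball 0 (1 / 200)"
  unfolding log_eigenvalue_def[abs_def]
proof (intro holomorphic_intros holomorphic_eigenvalue not_in_nonpos_Reals_near_1)
  fix \<tau> :: complex assume "\<tau> \<in> ball 0 (1 / 200)"
  then show "norm (eigenvalue \<tau> - 1) < 1"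
    using norm_eigenvalue_diff_1_le[of \<tau>] by simp
qed

lemma exp_log_eigenvalue:
  assumes "norm \<tau> \<le> 1 / 200"
  shows "exp (of_nat N * log_eigenvalue \<tau>) = eigenvalue \<tau> ^ N"
  using eigenvalue_nz(1)[OF assms] by (simp add: log_eigenvalue_def exp_of_nat_mult)

text \<open>The variance equals the second cumulant of \<open>scaled_moment k\<close> plus
  \<open>k\<close> times the derivative in question. The former is bounded in \<open>k\<close> and
  the variance is not.\<close>

lemma deriv2_log_eigenvalue_nz: "deriv (deriv log_eigenvalue) 0 \<noteq> 0"
proof
  assume 0: "deriv (deriv log_eigenvalue) 0 = 0"
  define B :: real where "B = 2 * exp 2 / (1 / 400)\<^sup>2 + (exp 2 / (1 / 400))\<^sup>2"
  obtain k where k: "log_variance k (1 / 2) > B"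
    using log_variance_unbounded by blast
  have "complex_of_real (log_variance k (1 / 2))
      = deriv (deriv (\<lambda>\<tau>. moment k \<tau> (1 / 2))) 0 - (deriv (\<lambda>\<tau>. moment k \<tau> (1 / 2)) 0)\<^sup>2"
    by (simp add: log_variance_def deriv_moment_at_0 deriv2_moment_at_0)
  also have "\<dots> = deriv (deriv (scaled_moment k)) 0 - (deriv (scaled_moment k) 0)\<^sup>2
      + of_nat k * deriv (deriv log_eigenvalue) 0"
  proof (rule second_cumulant_mult_exp)
    show "moment k \<tau> (1 / 2) = scaled_moment k \<tau> * exp (of_nat k * log_eigenvalue \<tau>)"
      if "\<tau> \<in> ball 0 (1 / 200)" for \<tau>
      using that eigenvalue_nz(1)[of \<tau>] by (simp add: exp_log_eigenvalue scaled_moment_def)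
  qed (use holomorphic_scaled_moment holomorphic_log_eigenvalue in
      \<open>auto simp: scaled_moment_0 log_eigenvalue_def eigenvalue_0\<close>)
  finally have "norm (complex_of_real (log_variance k (1 / 2)))
      = norm (deriv (deriv (scaled_moment k)) 0 - (deriv (scaled_moment k) 0)\<^sup>2)"
    by (simp add: 0)
  also have "\<dots> \<le> norm (deriv (deriv (scaled_moment k)) 0) + norm ((deriv (scaled_moment k) 0)\<^sup>2)"
    by (rule norm_triangle_ineq4)
  also have "\<dots> \<le> B"
    unfolding B_def norm_power
    using norm_scaled_moment_deriv_le[of 2 k] norm_scaled_moment_deriv_le[of 1 k]
    by (intro add_mono power_mono) (simp_all add: numeral_2_eq_2)
  finally show False using k by simp
qed

theorem theorem1p2:
  "\<exists>(\<eta>::real) (\<theta>::real) (U::complex \<Rightarrow> complex) (V::complex \<Rightarrow> complex).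
     \<eta> > 0 \<and> 0 \<le> \<theta> \<and> \<theta> < 1 \<and>
     U analytic_on cball 0 \<eta> \<and> V analytic_on cball 0 \<eta> \<and>
     (\<exists>(R::nat \<Rightarrow> complex \<Rightarrow> complex) (C::real).
        \<forall>N\<ge>1. \<forall>\<tau>\<in>cball 0 \<eta>.
          stern_moment N \<tau> = exp (of_nat N * U \<tau> + V \<tau>) * (1 + R N \<tau>) \<and>
          norm (R N \<tau>) \<le> C * \<theta> ^ N) \<and>
     (deriv ^^ 2) U 0 \<noteq> 0"
proof -
  have "continuous (at 0) stern_amplitude"
    using holomorphic_on_imp_continuous_on[OF holomorphic_stern_amplitude]
    by (simp add: continuous_on_eq_continuous_at)
  then obtain d where d: "d > 0" "\<And>\<tau>. norm \<tau> < d \<Longrightarrow> norm (stern_amplitude \<tau> - 1) < 1 / 2"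
    unfolding continuous_at_eps_delta by (force simp: stern_amplitude_0 dist_norm dest: spec[of _ "1 / 2"])
  \<comment> \<open>On this disc the amplitude stays within 1/2 of 1, so its principal logarithm is
    holomorphic. Halving the radius puts the closed disc inside it.\<close>
  define r where "r = min d (1 / 200)"
  define \<eta> where "\<eta> = r / 2"
  have r: "r > 0" "r \<le> 1 / 200" "r \<le> d" and sub: "cball 0 \<eta> \<subseteq> ball (0::complex) r"
    using d(1) by (auto simp: r_def \<eta>_def)
  have amp: "norm (stern_amplitude \<tau> - 1) < 1 / 2" if "\<tau> \<in> ball 0 r" for \<tau>
    using that r by (intro d(2)) auto
  define V where "V \<tau> = Ln (stern_amplitude \<tau>)" for \<tau>
  define R where "R N \<tau> = stern_moment N \<tau> / eigenvalue \<tau> ^ N / stern_amplitude \<tau> - 1" for N \<tau>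
  have analytic: "f analytic_on cball 0 \<eta>" if "f holomorphic_on ball 0 r" for f
    using that sub by (auto simp: analytic_on_holomorphic)
  have U: "log_eigenvalue analytic_on cball 0 \<eta>"
    using r by (intro analytic holomorphic_on_subset[OF holomorphic_log_eigenvalue]) auto
  have "V holomorphic_on ball 0 r"
    unfolding V_def[abs_def]
  proof (intro holomorphic_intros not_in_nonpos_Reals_near_1)
    show "stern_amplitude holomorphic_on ball 0 r"
      using r by (intro holomorphic_on_subset[OF holomorphic_stern_amplitude]) auto
    show "norm (stern_amplitude \<tau> - 1) < 1" if "\<tau> \<in> ball 0 r" for \<tau>
      using amp[OF that] by simp
  qed
  then have V: "V analytic_on cball 0 \<eta>" by (rule analytic)
  have "stern_moment N \<tau> = exp (of_nat N * log_eigenvalue \<tau> + V \<tau>) * (1 + R N \<tau>) \<and>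
      norm (R N \<tau>) \<le> 14 * exp 2 * (3 / 4) ^ N" if "\<tau> \<in> cball 0 \<eta>" for N \<tau>
  proof
    have \<tau>: "\<tau> \<in> ball 0 r" using that sub by blast
    then have small: "norm \<tau> \<le> 1 / 200" using r by simp
    have ge: "norm (stern_amplitude \<tau>) \<ge> 1 / 2"
      using amp[OF \<tau>] norm_triangle_ineq2[of 1 "stern_amplitude \<tau>"] by (simp add: norm_minus_commute)
    then have nz: "stern_amplitude \<tau> \<noteq> 0" by auto
    show "stern_moment N \<tau> = exp (of_nat N * log_eigenvalue \<tau> + V \<tau>) * (1 + R N \<tau>)"
      using nz eigenvalue_nz(1)[OF small]
      by (simp add: exp_add exp_log_eigenvalue[OF small] V_def R_def)
    have "R N \<tau> = (stern_moment N \<tau> / eigenvalue \<tau> ^ N - stern_amplitude \<tau>) / stern_amplitude \<tau>"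
      using nz by (simp add: R_def diff_divide_distrib)
    then have "norm (R N \<tau>)
        = norm (stern_moment N \<tau> / eigenvalue \<tau> ^ N - stern_amplitude \<tau>) / norm (stern_amplitude \<tau>)"
      by (simp only: norm_divide)
    \<comment> \<open>Passing to the relative error divides by an amplitude of norm at least 1/2,
      which doubles 7 to 14.\<close>
    also have "\<dots> \<le> 7 * exp 2 * (3 / 4) ^ N / (1 / 2)"
      using norm_stern_moment_diff_amplitude_le[OF small] amp[OF \<tau>] ge by (intro frac_le) auto
    finally show "norm (R N \<tau>) \<le> 14 * exp 2 * (3 / 4) ^ N" by simp
  qed
  moreover have "(deriv ^^ 2) log_eigenvalue 0 \<noteq> 0"
    using deriv2_log_eigenvalue_nz by (simp add: numeral_2_eq_2)
  moreover have "\<eta> > 0" using r by (simp add: \<eta>_def)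
  ultimately show ?thesis
    using U V by (intro exI[of _ \<eta>] exI[of _ "3 / 4"] exI[of _ log_eigenvalue] exI[of _ V] conjI
        exI[of _ R] exI[of _ "14 * exp 2"]) auto
qed

end
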